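(* Let $k \ge 1$, $T > 5k$ and $d > T$ be integers. For every deterministic $k$-th order algorithm working on $\mathbb{R}^d$ there exists a convex function $f : B_d \to \mathbb{R}$ such that, when the algorithm is run on $f$ for $T$ steps, every point $y \in B_d$ queried by the algorithm satisfies $$f(y) \ge \min_{x \in B_d} f(x) + \frac{1}{2\sqrt{T}}.$$ Moreover $f$ is $k$-times differentiable, with Lipschitz constants $L_{i+1}$ bounded as $$L_{i+1} \le (10k)^i\, T^{2.5 i} \qquad \text{for all } i \le k .$$
   Context: $B_d$ denotes the closed Euclidean unit ball of $\mathbb{R}^d$ and $\|\cdot\|$ the Euclidean norm. A function on $B_d$ is called $k$-times differentiable if it is the restriction of a $k$-times differentiable function on a neighbourhood of $B_d$, whose derivatives are used at boundary points. A deterministic $k$-th order algorithm accesses an unknown $k$-times differentiable function $f$ iteratively: at every step $i = 1, 2, \dots$ it queries a point $x_i \in B_d$ and receives the tuple $[f(x_i), \nabla f(x_i), \dots, \nabla^k f(x_i)]$; the point $x_i$ is a deterministic function of the tuples received at steps $1, \dots, i-1$ (so $x_1$ is fixed). For $0 \le i \le k$, $L_{i+1}$ denotes the Lipschitz constant of the $i$-th derivative: the smallest number with $\|\nabla^i f(x) - \nabla^i f(y)\| \le L_{i+1}\|x-y\|$ for all $x,y \in B_d$, where the norm of a derivative tensor is the operator norm induced by the Euclidean norm (and $\nabla^0 f = f$). *)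

theory Defs
  imports "HOL-Analysis.Analysis"
begin

abbreviation unit_ball :: "(real ^ 'n) set" where
  "unit_ball \<equiv> cball 0 1"

section \<open>Higher derivatives\<close>

text \<open>An \<open>i\<close>-linear form on \<open>real ^ 'n\<close> is represented by its values on lists of \<open>i\<close> vectors, as
  there is no HOL type of \<open>i\<close>-linear forms for variable \<open>i\<close>.\<close>

type_synonym 'n tensor = "(real ^ 'n) list \<Rightarrow> real"

text \<open>\<open>iter_deriv f [v\<^sub>1, \<dots>, v\<^sub>i] x\<close> is the value of the \<open>i\<close>-th derivative of \<open>f\<close> at \<open>x\<close> on
  \<open>v\<^sub>1, \<dots>, v\<^sub>i\<close>, where \<open>v\<^sub>i\<close> is the direction of the innermost (first) differentiation.\<close>

primrec iter_deriv :: "(real ^ 'n \<Rightarrow> real) \<Rightarrow> (real ^ 'n) list \<Rightarrow> real ^ 'n \<Rightarrow> real" where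
  "iter_deriv f [] = f"
| "iter_deriv f (v # vs) = (\<lambda>x. frechet_derivative (iter_deriv f vs) (at x) v)"

text \<open>The default value 0 on lists of a length other than \<open>i\<close> ensures that \<open>nabla i f x\<close> carries no
  information about derivatives of any other order.\<close>

definition nabla :: "nat \<Rightarrow> (real ^ 'n \<Rightarrow> real) \<Rightarrow> real ^ 'n \<Rightarrow> 'n tensor" where
  "nabla i f x = (\<lambda>vs. if length vs = i then iter_deriv f vs x else 0)"

text \<open>A map into the finite-dimensional space of \<open>i\<close>-linear forms is Frechet differentiable iff its
  evaluations at all fixed arguments \<open>vs\<close> are; so this says that the derivatives of order
  \<open>0, \<dots>, k - 1\<close> are Frechet differentiable at every point of \<open>U\<close>.\<close>

definition times_differentiable_on :: "nat \<Rightarrow> (real ^ 'n \<Rightarrow> real) \<Rightarrow> (real ^ 'n) set \<Rightarrow> bool" where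
  "times_differentiable_on k f U \<longleftrightarrow>
     (\<forall>i<k. \<forall>vs. length vs = i \<longrightarrow> (\<forall>x\<in>U. (\<lambda>z. nabla i f z vs) differentiable (at x)))"

text \<open>A function on the ball is given by a total function; its values on a neighbourhood of the ball
  serve as the differentiable extension. The
  derivatives at a boundary point do not depend on the choice of the extension, because the
  directions from that point into the ball span the whole space.\<close>

definition times_differentiable_on_ball :: "nat \<Rightarrow> (real ^ 'n \<Rightarrow> real) \<Rightarrow> bool" where
  "times_differentiable_on_ball k f \<longleftrightarrow>
     (\<exists>U. open U \<and> unit_ball \<subseteq> U \<and> times_differentiable_on k f U)"

section \<open>Lipschitz constants\<close>

text \<open>The operator norm induced by the Euclidean norm. The supremum is over a bounded set when \<open>A\<close>
  is \<open>i\<close>-linear.\<close>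

definition tensor_norm :: "nat \<Rightarrow> 'n::finite tensor \<Rightarrow> real" where
  "tensor_norm i A = (SUP vs\<in>{vs. length vs = i \<and> (\<forall>v\<in>set vs. norm v = 1)}. \<bar>A vs\<bar>)"

definition nabla_lipschitz :: "nat \<Rightarrow> (real ^ 'n \<Rightarrow> real) \<Rightarrow> real \<Rightarrow> bool" where
  "nabla_lipschitz i f M \<longleftrightarrow>
     (\<forall>x\<in>unit_ball. \<forall>y\<in>unit_ball.
        tensor_norm i (\<lambda>vs. nabla i f x vs - nabla i f y vs) \<le> M * norm (x - y))"

text \<open>\<open>L\<close> is the Lipschitz constant of the \<open>i\<close>-th derivative, written \<open>L\<^sub>i\<^sub>+\<^sub>1\<close> in the literature.
  In particular it is finite.\<close>

definition is_lipschitz_constant :: "nat \<Rightarrow> (real ^ 'n \<Rightarrow> real) \<Rightarrow> real \<Rightarrow> bool" where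
  "is_lipschitz_constant i f L \<longleftrightarrow>
     nabla_lipschitz i f L \<and> (\<forall>M. nabla_lipschitz i f M \<longrightarrow> L \<le> M)"

section \<open>Deterministic algorithms\<close>

definition oracle_answer :: "nat \<Rightarrow> (real ^ 'n \<Rightarrow> real) \<Rightarrow> real ^ 'n \<Rightarrow> 'n tensor list" where
  "oracle_answer k f x = map (\<lambda>i. nabla i f x) [0..<Suc k]"

text \<open>An algorithm maps the list of answers received so far to the next query point.\<close>

type_synonym 'n algorithm = "'n tensor list list \<Rightarrow> real ^ 'n"

definition valid_algorithm :: "'n::finite algorithm \<Rightarrow> bool" where
  "valid_algorithm A \<longleftrightarrow> (\<forall>h. A h \<in> unit_ball)"

primrec history :: "nat \<Rightarrow> 'n algorithm \<Rightarrow> (real ^ 'n \<Rightarrow> real) \<Rightarrow> nat \<Rightarrow> 'n tensor list list" where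
  "history k A f 0 = []"
| "history k A f (Suc n) = history k A f n @ [oracle_answer k f (A (history k A f n))]"

text \<open>Steps are numbered from 1: \<open>query k A f i\<close> depends on the answers of steps \<open>1, \<dots>, i - 1\<close>.\<close>

definition query :: "nat \<Rightarrow> 'n algorithm \<Rightarrow> (real ^ 'n \<Rightarrow> real) \<Rightarrow> nat \<Rightarrow> real ^ 'n" where
  "query k A f i = A (history k A f (i - 1))"

end

theory Submission
  imports Defs
begin

text \<open>The hard function is a smoothed version of \<open>g x = max\<^sub>i (s\<^sub>i * x $ J i - \<delta> i)\<close>, \<open>i < T\<close>, with
  signs \<open>s\<^sub>i\<close> and distinct coordinates \<open>J i\<close>. At the unit vector whose coordinate \<open>J i\<close> is
  \<open>- s\<^sub>i / sqrt T\<close>, every piece of \<open>g\<close> is at most \<open>- 1 / sqrt T\<close>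
  (\<open>signed_max_deep_point\<close>). An adversary keeps \<open>g\<close> nearly nonnegative at all queries: at the
  \<open>i\<close>-th query \<open>x\<close> it picks as \<open>J i\<close> the unused coordinate in which \<open>x\<close> is largest in absolute value,
  with the sign that makes \<open>s\<^sub>i * x $ J i\<close> nonnegative. Whatever coordinates and signs are picked later,
  their pieces lie at least \<open>\<delta>\<close> below the \<open>i\<close>-th one at \<open>x\<close>, so they are invisible in a cube of
  radius \<open>\<delta> / 2\<close> around \<open>x\<close> (\<open>signed_max_unchanged\<close>). If smoothing looks at a smaller cube only,
  the answer given at \<open>x\<close> stays correct after all later choices; hence signs and coordinates can be
  fixed one at a time along the run of the algorithm (\<open>exists_resisting_max\<close>).

  Smoothing is averaging over the cube \<open>[-r, r]\<^sup>n\<close>, done \<open>k\<close> times. Averages inherit convexity and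
  Lipschitz constants, and \<open>k\<close> rounds look at a cube of radius \<open>k r\<close> (\<open>smooth_pow_mono\<close>), whatever the
  dimension. Averaging along a coordinate turns the derivative along it into a difference quotient of
  step \<open>2 r\<close>. So one round makes every continuous function differentiable, and the derivative in a
  fixed direction is again an averaging operator applied to the function
  (\<open>has_derivative_smooth\<close>). These operators commute with further rounds by Fubini, so the \<open>i\<close>-th
  derivative of a \<open>k\<close>-fold average is a \<open>(k - i)\<close>-fold average of \<open>i\<close> of them applied to \<open>g\<close>
  (\<open>iter_deriv_smooth_pow\<close>). In a unit direction such an operator multiplies the Lipschitz constant by at
  most \<open>T / r\<close>, because \<open>g\<close> depends on \<open>T\<close> coordinates and each of them contributes a difference
  quotient, which costs a factor \<open>1 / r\<close>.

  The radius \<open>r = 1 / (10 k T sqrt T)\<close> makes \<open>T / r\<close> equal to \<open>10 k T powr 2.5\<close>. The step \<open>\<delta> = 4 k r\<close> exceeds the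
  bound \<open>2 k r\<close> that hiding requires, and smoothing and the steps together cost at most
  \<open>\<delta> T = 4 / (10 sqrt T)\<close>, less than half of the gap \<open>1 / sqrt T\<close>.\<close>

section \<open>Differentiability from continuous partial derivatives\<close>

text \<open>Change the coordinates of the argument one at a time; by the mean value inequality each change is
  linear up to the oscillation of one partial derivative near \<open>x\<close>. The induction is over the set of
  coordinates that have been changed.\<close>

lemma has_derivative_if_continuous_partials:
  fixes f :: "real ^ 'n::finite \<Rightarrow> real"
  assumes partial: "\<And>j x. ((\<lambda>t. f (x + t *\<^sub>R axis j 1)) has_real_derivative p j x) (at 0)"
    and cont: "\<And>j. continuous_on UNIV (p j)"
  shows "(f has_derivative (\<lambda>v. \<Sum>j\<in>UNIV. v $ j * p j x)) (at x)"
proof -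
  have along: "((\<lambda>t. f (z + t *\<^sub>R axis j 1)) has_real_derivative p j (z + s *\<^sub>R axis j 1)) (at s)"
    for j z s
    using partial[of "z + s *\<^sub>R axis j 1" j] DERIV_shift[of "\<lambda>t. f (z + t *\<^sub>R axis j 1)" _ 0 s]
    by (simp add: algebra_simps)
  define part where "part K v = (\<Sum>j\<in>K. (v $ j) *\<^sub>R axis j (1::real))" for K and v :: "real ^ 'n"
  have part_nth: "part K v $ i = (if i \<in> K then v $ i else 0)" for K v i
    unfolding part_def by (simp add: axis_def if_distrib sum.If_cases cong: if_cong)
  have approx: "\<forall>e>0. \<exists>d>0. \<forall>v. norm v < d \<longrightarrow>
        \<bar>f (x + part K v) - f x - (\<Sum>j\<in>K. v $ j * p j x)\<bar> \<le> e * norm v" for K :: "'n set"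
  proof (induction K rule: finite_induct[OF finite])
    case 1
    show ?case by (auto simp: part_def intro!: exI[of _ 1])
  next
    case (2 j K)
    show ?case
    proof (intro allI impI)
      fix e :: real assume "e > 0"
      then obtain d1 where d1: "d1 > 0" and K_approx: "\<And>v. norm v < d1 \<Longrightarrow>
          \<bar>f (x + part K v) - f x - (\<Sum>j\<in>K. v $ j * p j x)\<bar> \<le> e / 2 * norm v"
        using "2.IH"[rule_format, of "e / 2"] by auto
      obtain d2 where d2: "d2 > 0" and p_close: "\<And>z. dist z x < d2 \<Longrightarrow> dist (p j z) (p j x) < e / 2"
        using cont[of j] \<open>e > 0\<close> unfolding continuous_on_iff by (metis UNIV_I half_gt_zero)
      have "\<bar>f (x + part (insert j K) v) - f x - (\<Sum>j\<in>insert j K. v $ j * p j x)\<bar> \<le> e * norm v"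
        if v: "norm v < min d1 d2" for v
      proof -
        \<comment> \<open>On the segment from \<open>w\<close> in direction \<open>j\<close>, subtract the linear part and bound the slope of the rest.\<close>
        define w where "w = x + part K v"
        define S where "S = {-\<bar>v $ j\<bar>..\<bar>v $ j\<bar>}"
        have deriv: "((\<lambda>t. f (w + t *\<^sub>R axis j 1) - t * p j x) has_field_derivative
            p j (w + t *\<^sub>R axis j 1) - p j x) (at t within S)" for t
          using DERIV_subset[OF DERIV_diff[OF along[of w j t] DERIV_cmult_right[OF DERIV_ident, of "p j x"]]]
          by simp
        have small: "norm (p j (w + t *\<^sub>R axis j 1) - p j x) \<le> e / 2" if "t \<in> S" for t
        proof -
          have "norm (part K v + t *\<^sub>R axis j 1) \<le> norm v"
            using that \<open>j \<notin> K\<close>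
            by (intro norm_le_componentwise_cart) (auto simp: part_nth S_def axis_def)
          then show ?thesis
            using p_close[of "w + t *\<^sub>R axis j 1"] v
            by (simp add: w_def dist_norm add.assoc)
        qed
        have "norm ((f (w + (v $ j) *\<^sub>R axis j 1) - v $ j * p j x) - (f (w + 0 *\<^sub>R axis j 1) - 0 * p j x))
            \<le> e / 2 * norm (v $ j - 0)"
          by (rule field_differentiable_bound[OF _ deriv small]) (auto simp: S_def)
        also have "\<dots> \<le> e / 2 * norm v"
          using \<open>e > 0\<close> component_le_norm_cart[of v j] by (intro mult_left_mono) auto
        finally have "\<bar>f (w + (v $ j) *\<^sub>R axis j 1) - f w - v $ j * p j x\<bar> \<le> e / 2 * norm v"
          by (simp add: algebra_simps)
        moreover have "x + part (insert j K) v = w + (v $ j) *\<^sub>R axis j 1"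
          using \<open>j \<notin> K\<close> by (simp add: part_def w_def)
        moreover have "\<bar>f w - f x - (\<Sum>j\<in>K. v $ j * p j x)\<bar> \<le> e / 2 * norm v"
          using K_approx[of v] v by (simp add: w_def)
        moreover have "(\<Sum>j\<in>insert j K. v $ j * p j x) = v $ j * p j x + (\<Sum>j\<in>K. v $ j * p j x)"
          using \<open>j \<notin> K\<close> by simp
        ultimately show ?thesis
          by (simp only:)
      qed
      then show "\<exists>d>0. \<forall>v. norm v < d \<longrightarrow> \<bar>f (x + part (insert j K) v) - f x
          - (\<Sum>j\<in>insert j K. v $ j * p j x)\<bar> \<le> e * norm v"
        using d1 d2 by (intro exI[of _ "min d1 d2"]) auto
    qed
  qed
  have part_UNIV: "part UNIV v = v" for v
    by (simp add: vec_eq_iff part_nth)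
  have lin: "bounded_linear (\<lambda>v. \<Sum>j\<in>UNIV. v $ j * p j x)"
    by (intro bounded_linear_sum bounded_linear_compose[OF bounded_linear_mult_left]
        bounded_linear_vec_nth)
  show ?thesis
    unfolding has_derivative_at_alt
  proof (intro conjI lin allI impI)
    fix e :: real assume "e > 0"
    then obtain d where d: "d > 0" "\<And>v. norm v < d \<Longrightarrow>
        \<bar>f (x + v) - f x - (\<Sum>j\<in>UNIV. v $ j * p j x)\<bar> \<le> e * norm v"
      using approx[of UNIV] unfolding part_UNIV by blast
    show "\<exists>d>0. \<forall>y. norm (y - x) < d \<longrightarrow>
        norm (f y - f x - (\<Sum>j\<in>UNIV. (y - x) $ j * p j x)) \<le> e * norm (y - x)"
      using d(1) d(2)[of "_ - x"] by (intro exI[of _ d]) simp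
  qed
qed

section \<open>Averaging along one coordinate\<close>

definition avg :: "real \<Rightarrow> 'n::finite \<Rightarrow> (real ^ 'n \<Rightarrow> real) \<Rightarrow> real ^ 'n \<Rightarrow> real" where
  "avg r j h x = integral {-r..r} (\<lambda>t. h (x + t *\<^sub>R axis j 1)) / (2 * r)"

definition diff_quot :: "real \<Rightarrow> 'n::finite \<Rightarrow> (real ^ 'n \<Rightarrow> real) \<Rightarrow> real ^ 'n \<Rightarrow> real" where
  "diff_quot r j h x = (h (x + r *\<^sub>R axis j 1) - h (x - r *\<^sub>R axis j 1)) / (2 * r)"

lemma continuous_on_line:
  fixes h :: "real ^ 'n::finite \<Rightarrow> real"
  assumes "continuous_on UNIV h"
  shows "continuous_on S (\<lambda>t. h (x + t *\<^sub>R e))"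
  by (intro continuous_on_compose2[OF assms] continuous_intros) auto

lemma integrable_on_line:
  fixes h :: "real ^ 'n::finite \<Rightarrow> real"
  assumes "continuous_on UNIV h"
  shows "(\<lambda>t. h (x + t *\<^sub>R e)) integrable_on {a..b}"
  by (intro integrable_continuous_interval continuous_on_line assms)

lemma continuous_on_avg:
  assumes "continuous_on UNIV h"
  shows "continuous_on UNIV (avg r j h)"
proof -
  have "continuous_on UNIV (\<lambda>x. integral (cbox (-r) r) (\<lambda>t. h (x + t *\<^sub>R axis j 1)))"
    by (intro integral_continuous_on_param)
      (unfold case_prod_beta, intro continuous_on_compose2[OF assms] continuous_intros, simp)
  then show ?thesis
    unfolding avg_def[abs_def] divide_inverse cbox_interval by (intro continuous_intros)
qed

lemma continuous_on_diff_quot: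
  assumes "continuous_on UNIV h"
  shows "continuous_on UNIV (diff_quot r j h)"
  unfolding diff_quot_def[abs_def] divide_inverse
  by (intro continuous_intros continuous_on_compose2[OF assms]) auto

lemma avg_const: "r > 0 \<Longrightarrow> avg r j (\<lambda>_. c) = (\<lambda>_. c)"
  by (simp add: avg_def fun_eq_iff)

lemma avg_shift: "avg r j (\<lambda>x. h (x + a)) = (\<lambda>x. avg r j h (x + a))"
  by (simp add: avg_def fun_eq_iff algebra_simps)

lemma avg_add:
  assumes "continuous_on UNIV h1" "continuous_on UNIV h2"
  shows "avg r j (\<lambda>x. h1 x + h2 x) = (\<lambda>x. avg r j h1 x + avg r j h2 x)"
  using integrable_on_line[OF assms(1)] integrable_on_line[OF assms(2)]
  by (simp add: avg_def fun_eq_iff integral_add add_divide_distrib)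

lemma avg_cmult: "avg r j (\<lambda>x. c * h x) = (\<lambda>x. c * avg r j h x)"
  by (simp add: avg_def fun_eq_iff)

text \<open>Comparing the values around \<open>x\<close> with values around another point \<open>x'\<close> lets this lemma serve for
  bounds, for locality and for Lipschitz estimates alike.\<close>

lemma avg_mono:
  assumes "r > 0" "continuous_on UNIV h1" "continuous_on UNIV h2"
    and "\<And>t. \<bar>t\<bar> \<le> r \<Longrightarrow> h1 (x + t *\<^sub>R axis j 1) \<le> h2 (x' + t *\<^sub>R axis j 1)"
  shows "avg r j h1 x \<le> avg r j h2 x'"
  unfolding avg_def using assms
  by (intro divide_right_mono integral_le integrable_on_line) auto

text \<open>Fubini's theorem for a continuous integrand on a square.\<close>

lemma avg_commute:
  assumes "continuous_on UNIV h"
  shows "avg r i (avg r j h) = avg r j (avg r i h)"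
proof
  fix x
  have "integral (cbox (-r) r) (\<lambda>s. integral (cbox (-r) r) (\<lambda>t. h (x + s *\<^sub>R axis i 1 + t *\<^sub>R axis j 1)))
    = integral (cbox (-r) r) (\<lambda>t. integral (cbox (-r) r) (\<lambda>s. h (x + s *\<^sub>R axis i 1 + t *\<^sub>R axis j 1)))"
    by (intro integral_swap_continuous)
      (unfold case_prod_beta, intro continuous_on_compose2[OF assms] continuous_intros, simp)
  then show "avg r i (avg r j h) x = avg r j (avg r i h) x"
    by (simp add: avg_def ac_simps)
qed

text \<open>Moving the point moves the window of integration, so the fundamental theorem of calculus at both
  ends of the window gives a difference quotient of \<open>h\<close> itself: this is how each round of averaging
  gains one derivative.\<close>

lemma avg_has_derivative_along:
  assumes "r > 0" and cont: "continuous_on UNIV h"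
  shows "((\<lambda>s. avg r j h (x + s *\<^sub>R axis j 1)) has_real_derivative diff_quot r j h x) (at 0)"
proof -
  define \<phi> where "\<phi> t = h (x + t *\<^sub>R axis j 1)" for t
  \<comment> \<open>The base point \<open>-2 r\<close> leaves room on both sides of the window \<open>[s - r, s + r]\<close> for small \<open>s\<close>.\<close>
  define \<Phi> where "\<Phi> u = integral {-2*r..u} \<phi>" for u
  have cont_\<phi>: "continuous_on S \<phi>" for S
    unfolding \<phi>_def[abs_def] by (rule continuous_on_line[OF cont])
  have deriv: "(\<Phi> has_real_derivative \<phi> u) (at u)" if "-2 * r < u" "u < 2 * r" for u
  proof -
    have "(\<Phi> has_real_derivative \<phi> u) (at u within {-2*r..2*r})"
      unfolding \<Phi>_def[abs_def]
      by (rule integral_has_real_derivative[OF cont_\<phi>]) (use that in \<open>unfold atLeastAtMost_iff, linarith\<close>)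
    moreover have "at u within {-2*r..2*r} = at u"
      using that by (rule at_within_Icc_at)
    ultimately show ?thesis
      by (simp only:)
  qed
  have eq: "avg r j h (x + s *\<^sub>R axis j 1) = (\<Phi> (s + r) - \<Phi> (s - r)) / (2 * r)" if "\<bar>s\<bar> < r" for s
  proof -
    have "integral {-r..r} (\<lambda>t. h (x + s *\<^sub>R axis j 1 + t *\<^sub>R axis j 1))
        = integral {-r..r} (\<phi> \<circ> (\<lambda>t. t + s))"
      by (simp add: \<phi>_def o_def scaleR_add_left add.assoc add.commute[of "s *\<^sub>R axis j 1"])
    also have "\<dots> = integral {s - r..s + r} \<phi>"
      using integral_shift[OF cont_\<phi>, where a = "-r" and b = r and c = s]
      by (simp add: algebra_simps)
    also have "\<dots> = \<Phi> (s + r) - \<Phi> (s - r)"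
    proof -
      have "\<phi> integrable_on {-2*r..s + r}"
        by (rule integrable_continuous_interval[OF cont_\<phi>])
      moreover have "-2*r \<le> s - r" "s - r \<le> s + r"
        using that \<open>r > 0\<close> by linarith+
      ultimately have "integral {-2*r..s - r} \<phi> + integral {s - r..s + r} \<phi> = integral {-2*r..s + r} \<phi>"
        by (intro Henstock_Kurzweil_Integration.integral_combine)
      then show ?thesis by (simp add: \<Phi>_def)
    qed
    finally show ?thesis by (simp add: avg_def)
  qed
  have d1: "((\<lambda>s. \<Phi> (s + r)) has_real_derivative \<phi> r) (at 0)"
    by (rule DERIV_shift[THEN iffD1], unfold add_0_left, rule deriv) (use \<open>r > 0\<close> in linarith)+
  have d2: "((\<lambda>s. \<Phi> (s + - r)) has_real_derivative \<phi> (-r)) (at 0)"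
    by (rule DERIV_shift[THEN iffD1], unfold add_0_left, rule deriv) (use \<open>r > 0\<close> in linarith)+
  have quot: "((\<lambda>s. (\<Phi> (s + r) - \<Phi> (s + - r)) / (2 * r)) has_real_derivative diff_quot r j h x) (at 0)"
    using DERIV_cdivide[OF DERIV_diff[OF d1 d2], of "2 * r"]
    unfolding diff_quot_def \<phi>_def by simp
  have eq': "(\<Phi> (s + r) - \<Phi> (s + - r)) / (2 * r) = avg r j h (x + s *\<^sub>R axis j 1)"
    if "s \<in> {-r<..<r}" for s
  proof -
    have "\<bar>s\<bar> < r"
      using that unfolding greaterThanLessThan_iff by linarith
    then show ?thesis
      using eq[of s] by (simp only: diff_conv_add_uminus)
  qed
  have mem: "0 \<in> {-r<..<r}"
    using \<open>r > 0\<close> by simp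
  show ?thesis
    using has_field_derivative_transform_within_open[
        where g = "\<lambda>s. avg r j h (x + s *\<^sub>R axis j 1)", OF quot open_greaterThanLessThan mem] eq'
    by blast
qed

section \<open>Averaging over a cube\<close>

definition avg_list :: "real \<Rightarrow> 'n::finite list \<Rightarrow> (real ^ 'n \<Rightarrow> real) \<Rightarrow> real ^ 'n \<Rightarrow> real" where
  "avg_list r xs h = foldr (avg r) xs h"

lemma avg_list_simps [simp]:
  "avg_list r [] h = h"
  "avg_list r (j # xs) h = avg r j (avg_list r xs h)"
  by (simp_all add: avg_list_def)

lemma continuous_on_avg_list:
  "continuous_on UNIV h \<Longrightarrow> continuous_on UNIV (avg_list r xs h)"
  by (induction xs) (auto intro: continuous_on_avg)

lemma avg_list_const: "r > 0 \<Longrightarrow> avg_list r xs (\<lambda>_. c) = (\<lambda>_. c)"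
  by (induction xs) (simp_all add: avg_const)

lemma avg_list_shift: "avg_list r xs (\<lambda>x. h (x + a)) = (\<lambda>x. avg_list r xs h (x + a))"
  by (induction xs) (simp_all add: avg_shift)

lemma avg_list_add:
  assumes "continuous_on UNIV h1" "continuous_on UNIV h2"
  shows "avg_list r xs (\<lambda>x. h1 x + h2 x) = (\<lambda>x. avg_list r xs h1 x + avg_list r xs h2 x)"
  by (induction xs) (simp_all add: avg_add continuous_on_avg_list assms)

lemma avg_list_cmult: "avg_list r xs (\<lambda>x. c * h x) = (\<lambda>x. c * avg_list r xs h x)"
  by (induction xs) (simp_all add: avg_cmult)

lemma avg_list_sum:
  assumes "r > 0" "\<And>i. i \<in> I \<Longrightarrow> continuous_on UNIV (h i)"
  shows "avg_list r xs (\<lambda>x. \<Sum>i\<in>I. h i x) = (\<lambda>x. \<Sum>i\<in>I. avg_list r xs (h i) x)"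
  using assms(2)
proof (induction I rule: infinite_finite_induct)
  case (insert i I)
  then have "avg_list r xs (\<lambda>x. h i x + (\<Sum>i\<in>I. h i x))
      = (\<lambda>x. avg_list r xs (h i) x + avg_list r xs (\<lambda>x. \<Sum>i\<in>I. h i x) x)"
    by (intro avg_list_add continuous_on_sum) auto
  with insert show ?case by simp
qed (simp_all add: avg_list_const[OF assms(1)])

lemma avg_list_avg_commute:
  "continuous_on UNIV h \<Longrightarrow> avg_list r xs (avg r j h) = avg r j (avg_list r xs h)"
  by (induction xs) (simp_all add: avg_commute[of "avg_list r _ h"] continuous_on_avg_list)

lemma avg_list_commute:
  "continuous_on UNIV h \<Longrightarrow> avg_list r xs (avg_list r ys h) = avg_list r ys (avg_list r xs h)"
  by (induction ys) (simp_all add: avg_list_avg_commute continuous_on_avg_list)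

text \<open>Any listed coordinate can be taken as the outermost one; this reduces partial derivatives of a cube
  average to the case of one coordinate.\<close>

lemma avg_list_remove1:
  assumes "continuous_on UNIV h" "j \<in> set xs"
  shows "avg_list r xs h = avg r j (avg_list r (remove1 j xs) h)"
  using assms(2)
proof (induction xs)
  case (Cons i xs)
  then show ?case
    using assms(1) by (cases "i = j") (auto simp: avg_commute[of _ r i j] continuous_on_avg_list)
qed simp

lemma avg_list_diff_quot:
  assumes "continuous_on UNIV h"
  shows "avg_list r xs (diff_quot r j h) = diff_quot r j (avg_list r xs h)"
proof -
  have "diff_quot r j g = (\<lambda>x. 1 / (2 * r) * g (x + r *\<^sub>R axis j 1)
      + (- 1 / (2 * r)) * g (x + (- r) *\<^sub>R axis j 1))" for g
    by (simp add: diff_quot_def fun_eq_iff diff_divide_distrib)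
  moreover have "continuous_on UNIV (\<lambda>x. c * h (x + a))" for a c
    by (intro continuous_intros continuous_on_compose2[OF assms]) auto
  ultimately show ?thesis
    by (simp only: avg_list_add avg_list_cmult avg_list_shift)
qed

text \<open>A cube average depends only on the values in the cube of radius \<open>r\<close>. Distinctness matters: a
  repeated coordinate would widen the cube in that direction.\<close>

lemma avg_list_mono:
  assumes "r > 0" "continuous_on UNIV h1" "continuous_on UNIV h2" "distinct xs"
    and "\<And>y. (\<And>j. \<bar>y $ j\<bar> \<le> (if j \<in> set xs then r else 0)) \<Longrightarrow> h1 (x + y) \<le> h2 (x' + y)"
  shows "avg_list r xs h1 x \<le> avg_list r xs h2 x'"
  using assms(4,5)
proof (induction xs arbitrary: x x')
  case Nil
  from Nil(2)[of 0] show ?case by simp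
next
  case (Cons i xs)
  have "avg_list r xs h1 (x + t *\<^sub>R axis i 1) \<le> avg_list r xs h2 (x' + t *\<^sub>R axis i 1)"
    if t: "\<bar>t\<bar> \<le> r" for t
  proof (rule Cons.IH)
    show "distinct xs" using Cons.prems by simp
    fix y :: "real ^ 'a"
    assume y: "\<bar>y $ j\<bar> \<le> (if j \<in> set xs then r else 0)" for j
    have "\<bar>(t *\<^sub>R axis i 1 + y) $ j\<bar> \<le> (if j \<in> set (i # xs) then r else 0)" for j
      using y[of j] t Cons.prems(1) by (auto simp: axis_def split: if_splits)
    from Cons.prems(2)[OF this]
    show "h1 (x + t *\<^sub>R axis i 1 + y) \<le> h2 (x' + t *\<^sub>R axis i 1 + y)"
      by (simp add: add.assoc)
  qed
  then show ?case
    using assms(1-3) by (auto intro!: avg_mono continuous_on_avg_list)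
qed

definition coords :: "'n::finite list" where
  "coords = (SOME xs. set xs = UNIV \<and> distinct xs)"

lemma coords: "set (coords :: 'n::finite list) = UNIV" "distinct (coords :: 'n list)"
  using someI_ex[OF finite_distinct_list[OF finite[of "UNIV :: 'n set"]]] by (auto simp: coords_def)

definition smooth :: "real \<Rightarrow> (real ^ 'n::finite \<Rightarrow> real) \<Rightarrow> real ^ 'n \<Rightarrow> real" where
  "smooth r = avg_list r coords"

text \<open>The directional derivative of \<open>smooth r h\<close>, in a form that uses \<open>h\<close> alone and not its derivatives:
  along each coordinate the average is replaced by a difference quotient, and the averages over the
  other coordinates remain.\<close>

definition smooth_deriv :: "real \<Rightarrow> real ^ 'n::finite \<Rightarrow> (real ^ 'n \<Rightarrow> real) \<Rightarrow> real ^ 'n \<Rightarrow> real" where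
  "smooth_deriv r v h x = (\<Sum>j\<in>UNIV. v $ j * diff_quot r j (avg_list r (remove1 j coords) h) x)"

lemma continuous_on_smooth: "continuous_on UNIV h \<Longrightarrow> continuous_on UNIV (smooth r h)"
  by (simp add: smooth_def continuous_on_avg_list)

lemma continuous_on_smooth_deriv:
  "continuous_on UNIV h \<Longrightarrow> continuous_on UNIV (smooth_deriv r v h)"
  unfolding smooth_deriv_def[abs_def]
  by (intro continuous_intros continuous_on_diff_quot continuous_on_avg_list)

lemma has_derivative_smooth:
  assumes "r > 0" and cont: "continuous_on UNIV h"
  shows "(smooth r h has_derivative (\<lambda>v. smooth_deriv r v h x)) (at x)"
  unfolding smooth_deriv_def
proof (rule has_derivative_if_continuous_partials)
  fix j
  show "continuous_on UNIV (diff_quot r j (avg_list r (remove1 j coords) h))"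
    by (intro continuous_on_diff_quot continuous_on_avg_list cont)
  have "smooth r h = avg r j (avg_list r (remove1 j coords) h)"
    unfolding smooth_def by (intro avg_list_remove1 cont) (simp add: coords)
  then show "((\<lambda>t. smooth r h (x + t *\<^sub>R axis j 1)) has_real_derivative
      diff_quot r j (avg_list r (remove1 j coords) h) x) (at 0)" for x
    by (simp add: avg_has_derivative_along assms continuous_on_avg_list)
qed

text \<open>Both operators are built from shifts, linear combinations and averages, all of which commute.\<close>

lemma smooth_smooth_deriv_commute:
  assumes "r > 0" "continuous_on UNIV h"
  shows "smooth r (smooth_deriv r v h) = smooth_deriv r v (smooth r h)"
proof
  fix x
  have "avg_list r coords (\<lambda>x. v $ j * diff_quot r j (avg_list r (remove1 j coords) h) x) x
      = v $ j * diff_quot r j (avg_list r (remove1 j coords) (avg_list r coords h)) x" for j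
    using assms(2)
    by (simp add: avg_list_cmult avg_list_diff_quot continuous_on_avg_list
        avg_list_commute[of h r coords])
  then show "smooth r (smooth_deriv r v h) x = smooth_deriv r v (smooth r h) x"
    unfolding smooth_def smooth_deriv_def[abs_def]
    by (subst avg_list_sum)
      (auto intro!: assms continuous_intros continuous_on_diff_quot continuous_on_avg_list)
qed

lemma smooth_mono:
  assumes "r > 0" "continuous_on UNIV h1" "continuous_on UNIV h2"
    and "\<And>y. (\<And>j. \<bar>y $ j\<bar> \<le> r) \<Longrightarrow> h1 (x + y) \<le> h2 (x' + y)"
  shows "smooth r h1 x \<le> smooth r h2 x'"
  unfolding smooth_def
  by (rule avg_list_mono[OF assms(1-3) coords(2)]) (use assms(4) in \<open>simp add: coords(1)\<close>)

section \<open>Iterated averaging\<close>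

lemma continuous_on_smooth_pow:
  "continuous_on UNIV h \<Longrightarrow> continuous_on UNIV ((smooth r ^^ m) h)"
  by (induction m) (auto intro: continuous_on_smooth)

lemma smooth_pow_smooth_deriv_commute:
  assumes "r > 0" "continuous_on UNIV h"
  shows "(smooth r ^^ m) (smooth_deriv r v h) = smooth_deriv r v ((smooth r ^^ m) h)"
  by (induction m) (simp_all add: smooth_smooth_deriv_commute assms continuous_on_smooth_pow)

lemma continuous_on_smooth_derivs:
  "continuous_on UNIV h \<Longrightarrow> continuous_on UNIV (foldr (smooth_deriv r) vs h)"
  by (induction vs) (auto intro: continuous_on_smooth_deriv)

text \<open>Every differentiation consumes one round of averaging and leaves its \<open>smooth_deriv\<close> behind, which
  then moves inside past the remaining rounds.\<close>

lemma iter_deriv_smooth_pow: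
  assumes "r > 0" "continuous_on UNIV h" "length vs \<le> m"
  shows "iter_deriv ((smooth r ^^ m) h) vs = (smooth r ^^ (m - length vs)) (foldr (smooth_deriv r) vs h)"
  using assms(3)
proof (induction vs)
  case (Cons v vs)
  define g where "g = foldr (smooth_deriv r) vs h"
  have cont_g: "continuous_on UNIV g"
    unfolding g_def by (intro continuous_on_smooth_derivs assms)
  obtain q where q: "m - length vs = Suc q"
    using Cons.prems by (metis Suc_diff_Suc Suc_le_eq length_Cons)
  have "iter_deriv ((smooth r ^^ m) h) vs = smooth r ((smooth r ^^ q) g)"
    using Cons q by (simp add: g_def)
  moreover have "frechet_derivative (smooth r ((smooth r ^^ q) g)) (at x)
      = (\<lambda>v. smooth_deriv r v ((smooth r ^^ q) g) x)" for x
    using has_derivative_smooth[OF \<open>r > 0\<close> continuous_on_smooth_pow[OF cont_g]]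
    by (rule frechet_derivative_at[symmetric])
  moreover have "m - length (v # vs) = q"
    using q by simp
  ultimately show ?case
    by (simp add: smooth_pow_smooth_deriv_commute assms cont_g flip: g_def)
qed simp

lemma smooth_pow_mono:
  assumes "r > 0" "continuous_on UNIV h1" "continuous_on UNIV h2"
    and "\<And>y. (\<And>j. \<bar>y $ j\<bar> \<le> real m * r) \<Longrightarrow> h1 (x + y) \<le> h2 (x' + y)"
  shows "(smooth r ^^ m) h1 x \<le> (smooth r ^^ m) h2 x'"
  using assms(4)
proof (induction m arbitrary: x x')
  case 0
  from 0[of 0] show ?case by simp
next
  case (Suc m)
  have "smooth r ((smooth r ^^ m) h1) x \<le> smooth r ((smooth r ^^ m) h2) x'"
  proof (intro smooth_mono continuous_on_smooth_pow assms(1-3))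
    fix y :: "real ^ 'a" assume y: "\<bar>y $ j\<bar> \<le> r" for j
    show "(smooth r ^^ m) h1 (x + y) \<le> (smooth r ^^ m) h2 (x' + y)"
    proof (rule Suc.IH)
      fix z :: "real ^ 'a" assume z: "\<bar>z $ j\<bar> \<le> real m * r" for j
      have "\<bar>(y + z) $ j\<bar> \<le> real (Suc m) * r" for j
        using y[of j] z[of j] by (simp add: algebra_simps)
      from Suc.prems[OF this] show "h1 (x + y + z) \<le> h2 (x' + y + z)"
        by (simp add: add.assoc)
    qed
  qed
  then show ?case by simp
qed

lemma smooth_const: "r > 0 \<Longrightarrow> smooth r (\<lambda>_. c) = (\<lambda>_. c)"
  by (simp add: smooth_def avg_list_const)

lemma smooth_pow_const: "r > 0 \<Longrightarrow> (smooth r ^^ m) (\<lambda>_. c) = (\<lambda>_. c)"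
  by (induction m) (simp_all add: smooth_const)

section \<open>Lipschitz constants of averages and of their derivatives\<close>

lemma lipschitz_avg:
  assumes "r > 0" and lip: "M-lipschitz_on UNIV h"
  shows "M-lipschitz_on UNIV (avg r j h)"
proof -
  note cont = lipschitz_on_continuous_on[OF lip]
  have le: "avg r j h x \<le> avg r j h y + M * dist x y" for x y
  proof -
    have "avg r j h x \<le> avg r j (\<lambda>z. h z + M * dist x y) y"
    proof (intro avg_mono continuous_intros cont \<open>r > 0\<close>)
      fix t :: real
      show "h (x + t *\<^sub>R axis j 1) \<le> h (y + t *\<^sub>R axis j 1) + M * dist x y"
        using lipschitz_onD[OF lip, of "x + t *\<^sub>R axis j 1" "y + t *\<^sub>R axis j 1"]
        by (simp add: dist_real_def)
    qed
    also have "\<dots> = avg r j h y + M * dist x y"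
      using \<open>r > 0\<close> cont by (simp add: avg_add avg_const)
    finally show ?thesis .
  qed
  show ?thesis
  proof (rule lipschitz_onI)
    show "dist (avg r j h x) (avg r j h y) \<le> M * dist x y" for x y
      using le[of x y] le[of y x] by (simp add: dist_real_def dist_commute abs_le_iff)
    show "0 \<le> M" by (rule lipschitz_on_nonneg[OF lip])
  qed
qed

lemma lipschitz_avg_list:
  "r > 0 \<Longrightarrow> M-lipschitz_on UNIV h \<Longrightarrow> M-lipschitz_on UNIV (avg_list r xs h)"
  by (induction xs) (auto intro: lipschitz_avg)

lemma lipschitz_smooth_pow:
  "r > 0 \<Longrightarrow> M-lipschitz_on UNIV h \<Longrightarrow> M-lipschitz_on UNIV ((smooth r ^^ m) h)"
  by (induction m) (auto simp: smooth_def intro: lipschitz_avg_list)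

lemma lipschitz_diff_quot:
  assumes "r > 0" and lip: "M-lipschitz_on UNIV h"
  shows "(M / r)-lipschitz_on UNIV (diff_quot r j h)"
proof (rule lipschitz_onI)
  fix x y
  define e :: "real ^ 'a" where "e = r *\<^sub>R axis j 1"
  have "\<bar>h (x + e) - h (y + e)\<bar> \<le> M * dist x y" "\<bar>h (x - e) - h (y - e)\<bar> \<le> M * dist x y"
    using lipschitz_onD[OF lip, of "x + e" "y + e"] lipschitz_onD[OF lip, of "x - e" "y - e"]
    by (simp_all add: dist_norm)
  then have "\<bar>(h (x + e) - h (x - e)) - (h (y + e) - h (y - e))\<bar> \<le> 2 * (M * dist x y)"
    by linarith
  then show "dist (diff_quot r j h x) (diff_quot r j h y) \<le> M / r * dist x y"
    using \<open>r > 0\<close>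
    by (simp add: dist_real_def diff_quot_def divide_simps abs_mult flip: e_def diff_divide_distrib)
next
  show "0 \<le> M / r"
    using lipschitz_on_nonneg[OF lip] \<open>r > 0\<close> by simp
qed

text \<open>Stated through moves along single coordinates outside \<open>J\<close>, since this is the form in which
  difference quotients along such coordinates vanish.\<close>

definition depends_only_on :: "'n::finite set \<Rightarrow> (real ^ 'n \<Rightarrow> real) \<Rightarrow> bool" where
  "depends_only_on J h \<longleftrightarrow> (\<forall>j t x. j \<notin> J \<longrightarrow> h (x + t *\<^sub>R axis j 1) = h x)"

lemma depends_only_on_shift:
  assumes "depends_only_on J h"
  shows "depends_only_on J (\<lambda>x. h (x + a))"
  unfolding depends_only_on_def
proof (intro allI impI)
  fix j t x assume "j \<notin> J"
  then have "h (x + a + t *\<^sub>R axis j 1) = h (x + a)"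
    using assms by (simp add: depends_only_on_def)
  then show "h (x + t *\<^sub>R axis j 1 + a) = h (x + a)"
    by (simp add: ac_simps)
qed

lemma depends_only_on_avg:
  assumes "depends_only_on J h"
  shows "depends_only_on J (avg r i h)"
  using depends_only_on_shift[OF assms] by (simp add: depends_only_on_def avg_def)

lemma depends_only_on_avg_list:
  "depends_only_on J h \<Longrightarrow> depends_only_on J (avg_list r xs h)"
  by (induction xs) (auto intro: depends_only_on_avg)

lemma depends_only_on_diff_quot:
  assumes "depends_only_on J h"
  shows "depends_only_on J (diff_quot r i h)"
  using depends_only_on_shift[OF assms, of "r *\<^sub>R axis i 1"]
    depends_only_on_shift[OF assms, of "- (r *\<^sub>R axis i 1)"]
  by (simp add: depends_only_on_def diff_quot_def)

lemma depends_only_on_smooth_deriv: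
  assumes "depends_only_on J h"
  shows "depends_only_on J (smooth_deriv r v h)"
  using depends_only_on_diff_quot[OF depends_only_on_avg_list[OF assms]]
  by (simp add: depends_only_on_def smooth_deriv_def)

lemma diff_quot_eq_0:
  assumes "depends_only_on J h" "j \<notin> J"
  shows "diff_quot r j h x = 0"
proof -
  have "h (x + r *\<^sub>R axis j 1) = h x" "h (x + (- r) *\<^sub>R axis j 1) = h x"
    using assms unfolding depends_only_on_def by blast+
  then show ?thesis by (simp add: diff_quot_def)
qed

text \<open>Coordinates outside \<open>J\<close> contribute nothing, so the dimension of the space is replaced by
  \<open>card J\<close>; each of the others contributes a difference quotient with weight at most \<open>norm v = 1\<close>.\<close>

lemma lipschitz_smooth_deriv:
  assumes "r > 0" and lip: "M-lipschitz_on UNIV h" and dep: "depends_only_on J h"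
    and "norm v = 1"
  shows "(card J / r * M)-lipschitz_on UNIV (smooth_deriv r v h)"
proof (rule lipschitz_onI)
  define q where "q j = diff_quot r j (avg_list r (remove1 j coords) h)" for j
  have q_lip: "(M / r)-lipschitz_on UNIV (q j)" for j
    unfolding q_def by (intro lipschitz_diff_quot lipschitz_avg_list assms)
  have restrict: "smooth_deriv r v h x = (\<Sum>j\<in>J. v $ j * q j x)" for x
    unfolding smooth_deriv_def q_def
    by (intro sum.mono_neutral_right)
      (auto simp: diff_quot_eq_0[OF depends_only_on_avg_list[OF dep]])
  fix x y
  have "dist (smooth_deriv r v h x) (smooth_deriv r v h y) = \<bar>\<Sum>j\<in>J. v $ j * (q j x - q j y)\<bar>"
    by (simp add: restrict dist_real_def right_diff_distrib sum_subtractf)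
  also have "\<dots> \<le> (\<Sum>j\<in>J. \<bar>v $ j\<bar> * \<bar>q j x - q j y\<bar>)"
    by (rule order_trans[OF sum_abs]) (simp add: abs_mult)
  also have "\<dots> \<le> (\<Sum>j\<in>J. 1 * (M / r * dist x y))"
    using component_le_norm_cart[of v] \<open>norm v = 1\<close> lipschitz_onD[OF q_lip, of x y]
    by (intro sum_mono mult_mono) (auto simp: dist_real_def)
  finally show "dist (smooth_deriv r v h x) (smooth_deriv r v h y) \<le> card J / r * M * dist x y"
    by simp
next
  show "0 \<le> card J / r * M"
    using lipschitz_on_nonneg[OF lip] \<open>r > 0\<close> by simp
qed

lemma lipschitz_smooth_derivs:
  assumes "r > 0" "M-lipschitz_on UNIV h" "depends_only_on J h" "\<forall>v\<in>set vs. norm v = 1"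
  shows "((card J / r) ^ length vs * M)-lipschitz_on UNIV (foldr (smooth_deriv r) vs h)"
    and "depends_only_on J (foldr (smooth_deriv r) vs h)"
  using assms(4)
proof (induction vs)
  case (Cons v vs)
  case 1
  show ?case
    using lipschitz_smooth_deriv[OF assms(1) Cons.IH(1) Cons.IH(2), of v] 1
    by (simp add: mult.assoc)
next
  case (Cons v vs)
  case 2
  then show ?case
    using Cons.IH(2) by (simp add: depends_only_on_smooth_deriv)
qed (use assms in simp_all)

section \<open>Convexity and differentiability of averages\<close>

text \<open>The average at the point \<open>w\<close> between \<open>x\<close> and \<open>y\<close> is compared with averages at \<open>x\<close> and \<open>y\<close> by
  writing the latter as averages at \<open>w\<close> of shifted functions.\<close>

lemma convex_on_avg:
  assumes "r > 0" and cont: "continuous_on UNIV h" and conv: "convex_on UNIV h"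
  shows "convex_on UNIV (avg r j h)"
proof (rule convex_onI)
  fix s :: real and x y :: "real ^ 'a"
  assume s: "0 < s" "s < 1"
  define w where "w = (1 - s) *\<^sub>R x + s *\<^sub>R y"
  have cont': "continuous_on UNIV (\<lambda>z. c * h (z + a))" for c a
    by (intro continuous_intros continuous_on_compose2[OF cont]) auto
  have "avg r j h w \<le> avg r j (\<lambda>z. (1 - s) * h (z + (x - w)) + s * h (z + (y - w))) w"
  proof (intro avg_mono assms continuous_on_add cont')
    fix t :: real
    have "w + t *\<^sub>R axis j 1 = (1 - s) *\<^sub>R (x + t *\<^sub>R axis j 1) + s *\<^sub>R (y + t *\<^sub>R axis j 1)"
      by (simp add: w_def algebra_simps)
    also have "h \<dots> \<le> (1 - s) * h (x + t *\<^sub>R axis j 1) + s * h (y + t *\<^sub>R axis j 1)"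
      using s by (intro convex_onD[OF conv]) auto
    finally show "h (w + t *\<^sub>R axis j 1) \<le> (1 - s) * h (w + t *\<^sub>R axis j 1 + (x - w))
        + s * h (w + t *\<^sub>R axis j 1 + (y - w))"
      by (simp add: algebra_simps)
  qed
  also have "\<dots> = (1 - s) * avg r j h x + s * avg r j h y"
    by (simp add: avg_add[OF cont' cont'] avg_cmult avg_shift)
  finally show "avg r j h ((1 - s) *\<^sub>R x + s *\<^sub>R y) \<le> (1 - s) * avg r j h x + s * avg r j h y"
    by (simp add: w_def)
qed simp

lemma convex_on_avg_list:
  "r > 0 \<Longrightarrow> continuous_on UNIV h \<Longrightarrow> convex_on UNIV h \<Longrightarrow> convex_on UNIV (avg_list r xs h)"
  by (induction xs) (auto intro: convex_on_avg continuous_on_avg_list)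

lemma convex_on_smooth:
  "r > 0 \<Longrightarrow> continuous_on UNIV h \<Longrightarrow> convex_on UNIV h \<Longrightarrow> convex_on UNIV (smooth r h)"
  by (simp add: smooth_def convex_on_avg_list)

lemma convex_on_smooth_pow:
  "r > 0 \<Longrightarrow> continuous_on UNIV h \<Longrightarrow> convex_on UNIV h \<Longrightarrow> convex_on UNIV ((smooth r ^^ m) h)"
  by (induction m) (simp_all add: convex_on_smooth continuous_on_smooth_pow)

lemma times_differentiable_on_ball_smooth_pow:
  assumes "r > 0" "continuous_on UNIV h"
  shows "times_differentiable_on_ball m ((smooth r ^^ m) h)"
proof -
  have "(\<lambda>z. nabla i ((smooth r ^^ m) h) z vs) differentiable (at x)"
    if i: "i < m" "length vs = i" for i vs x
  proof -
    define g where "g = foldr (smooth_deriv r) vs h"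
    obtain q where q: "m - length vs = Suc q"
      using i by (metis Suc_diff_Suc)
    have "(smooth r ((smooth r ^^ q) g)) differentiable (at x)"
      using has_derivative_smooth[OF \<open>r > 0\<close>] assms(2)
      unfolding g_def differentiable_def
      by (blast intro: continuous_on_smooth_pow continuous_on_smooth_derivs)
    moreover have "(\<lambda>z. nabla i ((smooth r ^^ m) h) z vs) = smooth r ((smooth r ^^ q) g)"
      using that q by (simp add: nabla_def iter_deriv_smooth_pow assms g_def)
    ultimately show ?thesis by simp
  qed
  then show ?thesis
    unfolding times_differentiable_on_ball_def times_differentiable_on_def
    by (intro exI[of _ UNIV]) auto
qed

section \<open>Existence of the Lipschitz constants\<close>

text \<open>A Lipschitz bound for all evaluations of the derivative on unit vectors is one for its operator norm.
  The least constant is the infimum of all admissible ones, which is itself admissible because each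
  pair of points imposes a closed condition.\<close>

lemma least_lipschitz_constant:
  assumes "\<And>x y vs. length vs = i \<Longrightarrow> \<forall>v\<in>set vs. norm v = 1 \<Longrightarrow>
      \<bar>iter_deriv f vs x - iter_deriv f vs y\<bar> \<le> C * norm (x - y)"
  shows "\<exists>L. is_lipschitz_constant i f L \<and> L \<le> C"
proof -
  define N where "N x y = tensor_norm i (\<lambda>vs. nabla i f x vs - nabla i f y vs)" for x y
  define X where "X = {M. nabla_lipschitz i f M}"
  obtain u :: "real ^ 'a" where u: "norm u = 1"
    using vector_choose_size[of 1] by auto
  have "N x y \<le> C * norm (x - y)" for x y
    unfolding N_def tensor_norm_def
  proof (rule cSUP_least)
    have "replicate i u \<in> {vs. length vs = i \<and> (\<forall>v\<in>set vs. norm v = 1)}"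
      using u by simp
    then show "{vs :: (real ^ 'a) list. length vs = i \<and> (\<forall>v\<in>set vs. norm v = 1)} \<noteq> {}"
      by blast
  qed (use assms in \<open>auto simp: nabla_def\<close>)
  then have "C \<in> X"
    by (simp add: X_def nabla_lipschitz_def N_def)
  have quot_le: "N x y / norm (x - y) \<le> M"
    if "M \<in> X" "x \<in> unit_ball" "y \<in> unit_ball" "x \<noteq> y" for M x y
    using that by (simp add: X_def nabla_lipschitz_def N_def divide_le_eq)
  \<comment> \<open>Any two distinct points of the ball, such as \<open>u\<close> and \<open>0\<close>, bound the constants from below.\<close>
  have "u \<noteq> 0"
    using u by auto
  then have "bdd_below X"
    using quot_le[of _ u 0] u by (intro bdd_belowI[of _ "N u 0"]) auto
  have "nabla_lipschitz i f (Inf X)"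
    unfolding nabla_lipschitz_def
  proof (intro ballI)
 fix x y :: "real ^ 'a" assume xy: "x \<in> unit_ball" "y \<in> unit_ball"
    show "tensor_norm i (\<lambda>vs. nabla i f x vs - nabla i f y vs) \<le> Inf X * norm (x - y)"
    proof (cases "x = y")
      case True
      have "N x y \<le> C * norm (x - y)"
        using \<open>C \<in> X\<close> xy unfolding X_def nabla_lipschitz_def N_def by blast
      with True show ?thesis by (simp add: N_def)
    next
      case False
      then have "N x y / norm (x - y) \<le> Inf X"
        using \<open>C \<in> X\<close> quot_le xy by (intro cInf_greatest) auto
      with False show ?thesis by (simp add: N_def divide_le_eq)
    qed
  qed
  moreover have "Inf X \<le> M" if "nabla_lipschitz i f M" for M
    using that \<open>bdd_below X\<close> by (intro cInf_lower) (auto simp: X_def)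
  ultimately show ?thesis
    using \<open>C \<in> X\<close> by (auto simp: is_lipschitz_constant_def X_def)
qed

lemma least_lipschitz_constant_smooth_pow:
  assumes "r > 0" "M-lipschitz_on UNIV h" "depends_only_on J h" "i \<le> m"
  shows "\<exists>L. is_lipschitz_constant i ((smooth r ^^ m) h) L \<and> L \<le> (card J / r) ^ i * M"
proof (rule least_lipschitz_constant)
  fix x y :: "real ^ 'a" and vs :: "(real ^ 'a) list"
  assume vs: "length vs = i" "\<forall>v\<in>set vs. norm v = 1"
  have "((card J / r) ^ i * M)-lipschitz_on UNIV (iter_deriv ((smooth r ^^ m) h) vs)"
    using vs lipschitz_smooth_derivs(1)[OF assms(1-3) vs(2)] assms
    by (simp add: iter_deriv_smooth_pow lipschitz_on_continuous_on lipschitz_smooth_pow)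
  then show "\<bar>iter_deriv ((smooth r ^^ m) h) vs x - iter_deriv ((smooth r ^^ m) h) vs y\<bar>
      \<le> (card J / r) ^ i * M * norm (x - y)"
    using lipschitz_on_normD by fastforce
qed

section \<open>Locality of the answers\<close>

text \<open>The constant \<open>frechet_derivative\<close> chooses among the derivatives of a function at a point, and functions
  that agree near the point have the same derivatives there, possibly none.\<close>

lemma iter_deriv_cong_open:
  assumes "open U" "\<And>x. x \<in> U \<Longrightarrow> f x = g x" "x \<in> U"
  shows "iter_deriv f vs x = iter_deriv g vs x"
  using assms(3)
proof (induction vs arbitrary: x)
  case (Cons v vs)
  have "(iter_deriv f vs has_derivative D) (at x) \<longleftrightarrow> (iter_deriv g vs has_derivative D) (at x)" for D
    using has_derivative_transform_within_open[OF _ \<open>open U\<close> \<open>x \<in> U\<close>] Cons.IH by metis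
  then show ?case
    by (simp add: frechet_derivative_def)
qed (use assms in simp)

text \<open>Agreement on a cube slightly larger than the one used by the averages gives agreement of the
  averages on a neighbourhood of \<open>x\<close>, hence of all their derivatives at \<open>x\<close>.\<close>

lemma oracle_answer_smooth_pow_cong:
  assumes "r > 0" "e > 0" "continuous_on UNIV h1" "continuous_on UNIV h2"
    and eq: "\<And>y. (\<And>j. \<bar>y $ j - x $ j\<bar> \<le> real m * r + e) \<Longrightarrow> h1 y = h2 y"
  shows "oracle_answer k ((smooth r ^^ m) h1) x = oracle_answer k ((smooth r ^^ m) h2) x"
proof -
  have "(smooth r ^^ m) h1 z = (smooth r ^^ m) h2 z" if "z \<in> ball x e" for z
  proof -
    have "h1 (z + y) = h2 (z + y)" if y: "\<And>j. \<bar>y $ j\<bar> \<le> real m * r" for y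
    proof (rule eq)
      fix j
      have "\<bar>(z - x) $ j\<bar> \<le> e"
        using component_le_norm_cart[of "z - x" j] \<open>z \<in> ball x e\<close>
        by (simp add: dist_norm norm_minus_commute)
      then show "\<bar>(z + y) $ j - x $ j\<bar> \<le> real m * r + e"
        using y[of j] by simp
    qed
    then show ?thesis
      by (intro antisym smooth_pow_mono assms) simp_all
  qed
  then have "iter_deriv ((smooth r ^^ m) h1) vs x = iter_deriv ((smooth r ^^ m) h2) vs x" for vs
    using \<open>e > 0\<close> by (intro iter_deriv_cong_open[of "ball x e"]) auto
  then show ?thesis
    by (simp add: oracle_answer_def nabla_def cong: if_cong)
qed

section \<open>A maximum of signed coordinates\<close>

text \<open>The offset \<open>\<delta> i\<close> lets an earlier piece win against a later one when their coordinates are close.\<close>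

definition signed_max :: "real \<Rightarrow> (nat \<Rightarrow> real) \<Rightarrow> (nat \<Rightarrow> 'n::finite) \<Rightarrow> nat \<Rightarrow> real ^ 'n \<Rightarrow> real" where
  "signed_max \<delta> s J n x = Max ((\<lambda>i. s i * x $ J i - \<delta> * real i) ` {..<n})"

lemma signed_max_ge: "i < n \<Longrightarrow> s i * x $ J i - \<delta> * real i \<le> signed_max \<delta> s J n x"
  unfolding signed_max_def by (intro Max_ge) auto

lemma signed_max_le:
  "n > 0 \<Longrightarrow> (\<And>i. i < n \<Longrightarrow> s i * x $ J i - \<delta> * real i \<le> c) \<Longrightarrow> signed_max \<delta> s J n x \<le> c"
  unfolding signed_max_def by (intro Max.boundedI) auto

lemma signed_max_cong:
  assumes "\<And>i. i < n \<Longrightarrow> s i = s' i" "\<And>i. i < n \<Longrightarrow> J i = J' i"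
  shows "signed_max \<delta> s J n = signed_max \<delta> s' J' n"
  unfolding signed_max_def[abs_def] using assms by (auto intro!: ext arg_cong[of _ _ Max] image_cong)

lemma signed_coord_le:
  fixes x y :: "real ^ 'n::finite"
  assumes "\<bar>s\<bar> = (1::real)" "\<bar>x $ j - y $ j\<bar> \<le> c"
  shows "s * x $ j \<le> s * y $ j + c"
proof -
  have "s * (x $ j - y $ j) \<le> \<bar>s * (x $ j - y $ j)\<bar>"
    by (rule abs_ge_self)
  also have "\<dots> \<le> c"
    using assms by (simp add: abs_mult)
  finally show ?thesis
    by (simp add: right_diff_distrib)
qed

lemma lipschitz_signed_max:
  assumes "n > 0" "\<And>i. \<bar>s i\<bar> = 1"
  shows "1-lipschitz_on UNIV (signed_max \<delta> s J n)"
proof -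
  have le: "signed_max \<delta> s J n x \<le> signed_max \<delta> s J n y + dist x y" for x y
  proof (rule signed_max_le[OF \<open>n > 0\<close>])
    fix i assume "i < n"
    have "\<bar>x $ J i - y $ J i\<bar> \<le> dist x y"
      using component_le_norm_cart[of "x - y" "J i"] by (simp add: dist_norm)
    then show "s i * x $ J i - \<delta> * real i \<le> signed_max \<delta> s J n y + dist x y"
      using signed_coord_le[OF assms(2)[of i], of x "J i" y] signed_max_ge[OF \<open>i < n\<close>, of s y J \<delta>]
      by fastforce
  qed
  show ?thesis
  proof (rule lipschitz_onI)
    show "dist (signed_max \<delta> s J n x) (signed_max \<delta> s J n y) \<le> 1 * dist x y" for x y
      using le[of x y] le[of y x] by (simp add: dist_real_def dist_commute abs_le_iff)
  qed simp
qed

lemma convex_on_signed_max: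
  assumes "n > 0"
  shows "convex_on UNIV (signed_max \<delta> s J n)"
proof (rule convex_onI)
  fix t :: real and x y :: "real ^ 'a"
  assume t: "0 < t" "t < 1"
  show "signed_max \<delta> s J n ((1 - t) *\<^sub>R x + t *\<^sub>R y)
      \<le> (1 - t) * signed_max \<delta> s J n x + t * signed_max \<delta> s J n y"
  proof (rule signed_max_le[OF \<open>n > 0\<close>])
    fix i assume "i < n"
    have "s i * ((1 - t) *\<^sub>R x + t *\<^sub>R y) $ J i - \<delta> * real i
        = (1 - t) * (s i * x $ J i - \<delta> * real i) + t * (s i * y $ J i - \<delta> * real i)"
      by (simp add: algebra_simps)
    also have "\<dots> \<le> (1 - t) * signed_max \<delta> s J n x + t * signed_max \<delta> s J n y"
      using t by (intro add_mono mult_left_mono signed_max_ge \<open>i < n\<close>) auto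
    finally show "s i * ((1 - t) *\<^sub>R x + t *\<^sub>R y) $ J i - \<delta> * real i
      \<le> (1 - t) * signed_max \<delta> s J n x + t * signed_max \<delta> s J n y" .
  qed
qed simp

lemma depends_only_on_signed_max: "depends_only_on (J ` {..<n}) (signed_max \<delta> s J n)"
  unfolding depends_only_on_def signed_max_def
  by (auto intro!: arg_cong[of _ _ Max] image_cong simp: axis_def)

text \<open>At \<open>x\<close>, piece \<open>i\<close> has the largest absolute coordinate among itself and all pieces from \<open>n\<close> on, its
  sign is the favourable one, and its offset is smaller by at least \<open>\<delta>\<close>. Passing from \<open>x\<close> to \<open>y\<close>
  changes each of the two competing pieces by at most \<open>\<rho>\<close>.\<close>

lemma signed_max_unchanged:
  assumes "\<And>i. \<bar>s i\<bar> = 1" "i < n" "n \<le> N"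
    and query: "0 \<le> s i * x $ J i" "\<And>m. n \<le> m \<Longrightarrow> m < N \<Longrightarrow> \<bar>x $ J m\<bar> \<le> \<bar>x $ J i\<bar>"
    and near: "\<And>j. \<bar>y $ j - x $ j\<bar> \<le> \<rho>" and "2 * \<rho> \<le> \<delta>"
  shows "signed_max \<delta> s J N y = signed_max \<delta> s J n y"
proof (rule antisym)
  have "0 \<le> \<rho>"
    using near[of undefined] by linarith
  show "signed_max \<delta> s J N y \<le> signed_max \<delta> s J n y"
  proof (rule signed_max_le)
    show "N > 0" using assms by simp
    fix m assume "m < N"
    show "s m * y $ J m - \<delta> * real m \<le> signed_max \<delta> s J n y"
    proof (cases "m < n")
      case True
      then show ?thesis by (rule signed_max_ge)
    next
      case False
      have "s m * x $ J m \<le> \<bar>x $ J m\<bar>"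
        using abs_ge_self[of "s m * x $ J m"] assms(1) by (simp add: abs_mult)
      also have "\<dots> \<le> s i * x $ J i"
        using query False \<open>m < N\<close> abs_of_nonneg[OF query(1)] assms(1)[of i] by (simp add: abs_mult)
      finally have "s m * x $ J m \<le> s i * x $ J i" .
      moreover have "s m * y $ J m \<le> s m * x $ J m + \<rho>" "s i * x $ J i \<le> s i * y $ J i + \<rho>"
        using near by (auto intro!: signed_coord_le assms(1) simp: abs_minus_commute)
      moreover have "\<delta> * real (i + 1) \<le> \<delta> * real m"
        using False \<open>i < n\<close> \<open>0 \<le> \<rho>\<close> \<open>2 * \<rho> \<le> \<delta>\<close> by (intro mult_left_mono) auto
      ultimately show ?thesis
        using signed_max_ge[OF \<open>i < n\<close>, of s y J \<delta>] \<open>2 * \<rho> \<le> \<delta>\<close>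
        by (simp add: algebra_simps)
    qed
  qed
  show "signed_max \<delta> s J n y \<le> signed_max \<delta> s J N y"
    using assms by (intro signed_max_le signed_max_ge) auto
qed

section \<open>The resisting oracle\<close>

text \<open>The invariant of the adversary. The condition on the query at step \<open>i\<close> covers all coordinates
  different from \<open>J 0, \<dots>, J i\<close> and not just those of later pieces, so that it survives any later choice.
  Here steps are numbered from 0.\<close>

definition resists :: "nat \<Rightarrow> 'n::finite algorithm \<Rightarrow> (real ^ 'n \<Rightarrow> real)
    \<Rightarrow> (nat \<Rightarrow> real) \<Rightarrow> (nat \<Rightarrow> 'n) \<Rightarrow> nat \<Rightarrow> bool" where
  "resists k A f s J n \<longleftrightarrow> (\<forall>i<n. 0 \<le> s i * A (history k A f i) $ J i \<and>
     (\<forall>j. j \<notin> J ` {..i} \<longrightarrow> \<bar>A (history k A f i) $ j\<bar> \<le> \<bar>A (history k A f i) $ J i\<bar>))"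

text \<open>One piece is added per query. The \<open>n\<close>-th query is determined by the answers to the earlier ones, and
  these are the same for the old and the new maximum, so the new piece can be adapted to this query.
  The strict inequality in \<open>gap\<close> leaves room for a neighbourhood of the query.\<close>

lemma exists_resisting_max:
  fixes A :: "'n::finite algorithm"
  assumes "r > 0" and gap: "2 * (real m * r) < \<delta>" and "n \<le> CARD('n)"
  shows "\<exists>s J. (\<forall>i. \<bar>s i\<bar> = 1) \<and> inj_on J {..<n} \<and>
    resists k A ((smooth r ^^ m) (signed_max \<delta> s J n)) s J n"
  using assms(3)
proof (induction n)
  case 0
  show ?case by (auto simp: resists_def intro!: exI[of _ "\<lambda>_. 1"])
next
  case (Suc n)
  then obtain s J where s: "\<And>i. \<bar>s i\<bar> = 1" and inj: "inj_on J {..<n}"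
    and resists: "resists k A ((smooth r ^^ m) (signed_max \<delta> s J n)) s J n"
    by auto
  define f where "f = (smooth r ^^ m) (signed_max \<delta> s J n)"
  define x where "x i = A (history k A f i)" for i
  have "card (J ` {..<n}) < CARD('n)"
    using Suc.prems card_image_le[of "{..<n}" J] by simp
  then have "J ` {..<n} \<noteq> UNIV"
    by auto
  then have ne: "- J ` {..<n} \<noteq> {}"
    by auto
  define X where "X = (\<lambda>i. \<bar>x n $ i\<bar>) ` (- J ` {..<n})"
  have "Max X \<in> X"
    using ne unfolding X_def by (intro Max_in) auto
  then obtain j where j: "j \<in> - J ` {..<n}" "Max X = \<bar>x n $ j\<bar>"
    unfolding X_def by blast
  have j_max: "\<bar>x n $ i\<bar> \<le> \<bar>x n $ j\<bar>" if "i \<in> - J ` {..<n}" for i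
    unfolding j(2)[symmetric] X_def using that by (intro Max_ge) auto
  define s' where "s' = s(n := if x n $ j \<ge> 0 then 1 else - 1)"
  define J' where "J' = J(n := j)"
  define f' where "f' = (smooth r ^^ m) (signed_max \<delta> s' J' (Suc n))"
  have s': "\<bar>s' i\<bar> = 1" for i
    using s by (simp add: s'_def)
  have old: "s' i = s i" "J' i = J i" if "i < n" for i
    using that by (simp_all add: s'_def J'_def)
  have query: "0 \<le> s i * x i $ J i" "\<And>j. j \<notin> J ` {..i} \<Longrightarrow> \<bar>x i $ j\<bar> \<le> \<bar>x i $ J i\<bar>" if "i < n" for i
    using resists that unfolding resists_def f_def x_def by auto
  have answer: "oracle_answer k f' (x i) = oracle_answer k f (x i)" if "i < n" for i
    unfolding f'_def f_def
  proof (rule oracle_answer_smooth_pow_cong)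
    \<comment> \<open>\<open>e\<close> is chosen so that the cube to be inspected has radius exactly \<open>\<delta> / 2\<close>.\<close>
    define e where "e = \<delta> / 2 - real m * r"
    show "e > 0" using gap by (simp add: e_def)
    show "continuous_on UNIV (signed_max \<delta> s' J' (Suc n))" "continuous_on UNIV (signed_max \<delta> s J n)"
      using that s s'
      by (auto intro!: lipschitz_on_continuous_on lipschitz_signed_max)
    fix y :: "real ^ 'n" assume y: "\<bar>y $ j - x i $ j\<bar> \<le> real m * r + e" for j
    have "j \<notin> J ` {..i}"
      using j that by auto
    have "signed_max \<delta> s' J' (Suc n) y = signed_max \<delta> s' J' n y"
    proof (rule signed_max_unchanged[OF s' \<open>i < n\<close>])
      show "0 \<le> s' i * x i $ J' i"
        using query(1) old \<open>i < n\<close> by simp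
      show "\<bar>x i $ J' l\<bar> \<le> \<bar>x i $ J' i\<bar>" if "n \<le> l" "l < Suc n" for l
      proof -
        have "l = n" using that by simp
        then show ?thesis
          using query(2)[OF \<open>i < n\<close> \<open>j \<notin> J ` {..i}\<close>] old \<open>i < n\<close> by (simp add: J'_def)
      qed
      show "\<bar>y $ l - x i $ l\<bar> \<le> \<delta> / 2" for l
        using y[of l] by (simp add: e_def)
    qed simp_all
    also have "signed_max \<delta> s' J' n = signed_max \<delta> s J n"
      using old by (intro signed_max_cong) auto
    finally show "signed_max \<delta> s' J' (Suc n) y = signed_max \<delta> s J n y" .
  qed (rule \<open>r > 0\<close>)
  have history: "history k A f' i = history k A f i" if "i \<le> n" for i
    using that
  proof (induction i)
    case (Suc i)
    then show ?case using answer[of i] by (simp add: x_def)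
  qed simp
  have "inj_on J' {..<Suc n}"
    using inj j old unfolding inj_on_def J'_def by (auto simp: less_Suc_eq)
  moreover have "resists k A f' s' J' (Suc n)"
    unfolding resists_def
  proof (intro allI impI)
    fix i assume "i < Suc n"
    have x': "A (history k A f' i) = x i"
      using history[of i] \<open>i < Suc n\<close> by (simp add: x_def)
    show "0 \<le> s' i * A (history k A f' i) $ J' i \<and>
      (\<forall>j. j \<notin> J' ` {..i} \<longrightarrow> \<bar>A (history k A f' i) $ j\<bar> \<le> \<bar>A (history k A f' i) $ J' i\<bar>)"
    proof (cases "i = n")
      case True
      have "J' ` {..n} = insert j (J ` {..<n})"
        by (auto simp: J'_def image_def le_less)
      then show ?thesis
        using j_max x' unfolding True by (auto simp: s'_def J'_def)
    next
      case False
      then have "i < n" using \<open>i < Suc n\<close> by simp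
      moreover have "J' ` {..i} = J ` {..i}"
        using old \<open>i < n\<close> by (intro image_cong) auto
      ultimately show ?thesis
        unfolding x' using query old by simp
    qed
  qed
  ultimately show ?case
    using s' unfolding f'_def by blast
qed

section \<open>The lower bound\<close>

text \<open>The point is supported on the \<open>n\<close> coordinates \<open>J i\<close>, which are distinct, with entries of absolute
  value \<open>1 / sqrt n\<close>.\<close>

lemma signed_max_deep_point:
  fixes J :: "nat \<Rightarrow> 'n::finite"
  assumes "n > 0" "\<And>i. \<bar>s i\<bar> = 1" "inj_on J {..<n}"
  obtains z :: "real ^ 'n" where "norm z = 1" "\<And>i. i < n \<Longrightarrow> s i * z $ J i = - 1 / sqrt n"
proof
  define z :: "real ^ 'n" where
    "z = (\<chi> j. if j \<in> J ` {..<n} then - s (the_inv_into {..<n} J j) / sqrt n else 0)"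
  have sq: "s i * s i = 1" for i
    using assms(2)[of i] abs_mult_self_eq[of "s i"] by simp
  have z_J: "z $ J i = - s i / sqrt n" if "i < n" for i
    using that the_inv_into_f_f[OF assms(3), of i] by (simp add: z_def)
  then show "s i * z $ J i = - 1 / sqrt n" if "i < n" for i
    using that by (simp add: sq)
  have "(\<Sum>j\<in>UNIV. (z $ j)\<^sup>2) = (\<Sum>j\<in>J ` {..<n}. (z $ j)\<^sup>2)"
    by (intro sum.mono_neutral_right) (auto simp: z_def)
  also have "\<dots> = (\<Sum>i<n. (z $ J i)\<^sup>2)"
    using assms(3) by (simp add: sum.reindex)
  also have "\<dots> = (\<Sum>i<n. 1 / real n)"
    using sq by (intro sum.cong) (auto simp: z_J power2_eq_square)
  also have "\<dots> = 1"
    using \<open>n > 0\<close> by simp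
  finally show "norm z = 1"
    by (simp add: norm_vec_def L2_set_def)
qed

theorem theorem4p1:
  fixes k T :: nat and A :: "'n::finite algorithm"
  assumes "k \<ge> 1" and "T > 5 * k" and "CARD('n) > T"
    and "valid_algorithm A"
  shows "\<exists>f :: real ^ 'n \<Rightarrow> real.
           convex_on unit_ball f \<and>
           (\<exists>x\<^sub>0. is_arg_min f (\<lambda>x. x \<in> unit_ball) x\<^sub>0 \<and>
              (\<forall>i\<in>{1..T}. f (query k A f i) \<ge> f x\<^sub>0 + 1 / (2 * sqrt (real T)))) \<and>
           times_differentiable_on_ball k f \<and>
           (\<forall>i\<le>k. \<exists>L. is_lipschitz_constant i f L \<and>
              L \<le> (10 * real k) ^ i * real T powr (2.5 * real i))"
proof -
  have "T > 0" using assms by simp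
  define r where "r = 1 / (10 * real k * (real T * sqrt T))"
  define \<delta> where "\<delta> = 4 * (real k * r)"
  have "r > 0" using assms \<open>T > 0\<close> by (simp add: r_def)
  then have "\<delta> > 0" using \<open>k \<ge> 1\<close> by (simp add: \<delta>_def)
  obtain s and J :: "nat \<Rightarrow> 'n" where s: "\<And>i. \<bar>s i\<bar> = 1" and inj: "inj_on J {..<T}"
    and resists: "resists k A ((smooth r ^^ k) (signed_max \<delta> s J T)) s J T"
    using exists_resisting_max[of r k \<delta> T k A] \<open>r > 0\<close> \<open>k \<ge> 1\<close> assms(3) by (auto simp: \<delta>_def)
  define g where "g = signed_max \<delta> s J T"
  define f where "f = (smooth r ^^ k) g"
  have lip_g: "1-lipschitz_on UNIV g"
    unfolding g_def using \<open>T > 0\<close> s by (intro lipschitz_signed_max) auto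
  then have cont_g: "continuous_on UNIV g"
    by (rule lipschitz_on_continuous_on)
  have cont_f: "continuous_on UNIV f"
    unfolding f_def by (intro continuous_on_smooth_pow cont_g)
  have conv: "convex_on unit_ball f"
    unfolding f_def g_def using \<open>T > 0\<close> \<open>r > 0\<close> cont_g[unfolded g_def]
    by (intro convex_on_subset[OF convex_on_smooth_pow] convex_on_signed_max) auto
  have "real k * r = 1 / (10 * real T * sqrt T)"
    using \<open>k \<ge> 1\<close> by (simp add: r_def)
  then have \<delta>_T: "\<delta> * T \<le> 1 / (2 * sqrt T)"
    using \<open>T > 0\<close> by (simp add: \<delta>_def field_simps)
  \<comment> \<open>The step \<open>i\<close> of \<open>query\<close>, numbered from 1, meets the piece \<open>i - 1\<close>, which is nonnegative before its
    offset; averaging lowers it by at most \<open>k r\<close>.\<close>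
  have query_ge: "- (real k * r) - \<delta> * real (T - 1) \<le> f (query k A f i)" if "i \<in> {1..T}" for i
  proof -
    define x where "x = query k A f i"
    have i: "i - 1 < T" "real (i - 1) \<le> real (T - 1)" using that by auto
    have pos: "0 \<le> s (i - 1) * x $ J (i - 1)"
      using resists i(1) by (simp add: resists_def x_def query_def f_def g_def)
    have "(smooth r ^^ k) (\<lambda>_. - (real k * r) - \<delta> * real (T - 1)) x \<le> (smooth r ^^ k) g x"
    proof (intro smooth_pow_mono \<open>r > 0\<close> cont_g continuous_on_const)
      fix y :: "real ^ 'n" assume y: "\<bar>y $ j\<bar> \<le> real k * r" for j
      have "s (i - 1) * x $ J (i - 1) \<le> s (i - 1) * (x + y) $ J (i - 1) + real k * r"
        by (rule signed_coord_le[OF s]) (use y in simp)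
      moreover have "\<delta> * real (i - 1) \<le> \<delta> * real (T - 1)"
        using \<open>\<delta> > 0\<close> i by (intro mult_left_mono) auto
      ultimately show "- (real k * r) - \<delta> * real (T - 1) \<le> g (x + y)"
        using pos signed_max_ge[OF i(1), of s "x + y" J \<delta>] by (simp add: g_def)
    qed
    then show ?thesis
      using \<open>r > 0\<close> by (simp add: smooth_pow_const f_def x_def)
  qed
  obtain z :: "real ^ 'n" where z: "norm z = 1" "\<And>i. i < T \<Longrightarrow> s i * z $ J i = - 1 / sqrt T"
    using signed_max_deep_point[where s = s, OF \<open>T > 0\<close> s inj] by blast
  have "(smooth r ^^ k) g z \<le> (smooth r ^^ k) (\<lambda>_. - 1 / sqrt T + real k * r) z"
  proof (intro smooth_pow_mono \<open>r > 0\<close> cont_g continuous_on_const)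
    fix y :: "real ^ 'n" assume y: "\<bar>y $ j\<bar> \<le> real k * r" for j
    show "g (z + y) \<le> - 1 / sqrt T + real k * r"
      unfolding g_def
    proof (rule signed_max_le[OF \<open>T > 0\<close>])
      fix i assume "i < T"
      have "s i * (z + y) $ J i \<le> s i * z $ J i + real k * r"
        by (rule signed_coord_le[OF s]) (use y in simp)
      then show "s i * (z + y) $ J i - \<delta> * real i \<le> - 1 / sqrt T + real k * r"
        using z(2)[OF \<open>i < T\<close>] mult_nonneg_nonneg[of \<delta> "real i"] \<open>\<delta> > 0\<close> by linarith
    qed
  qed
  then have f_z: "f z \<le> - 1 / sqrt T + real k * r"
    using \<open>r > 0\<close> by (simp add: smooth_pow_const f_def)
  have "\<exists>x\<in>unit_ball. \<forall>y\<in>unit_ball. f x \<le> f y"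
    using continuous_on_subset[OF cont_f subset_UNIV] by (intro continuous_attains_inf) auto
  then obtain x0 where x0: "x0 \<in> unit_ball" "\<And>y. y \<in> unit_ball \<Longrightarrow> f x0 \<le> f y"
    by blast
  have "f (query k A f i) \<ge> f x0 + 1 / (2 * sqrt T)" if "i \<in> {1..T}" for i
  proof -
    have "f x0 \<le> real k * r - 1 / sqrt T"
      using x0(2)[of z] z(1) f_z by simp
    moreover have "\<delta> * real (T - 1) + 2 * (real k * r) \<le> \<delta> * T"
      using \<open>T > 0\<close> \<open>r > 0\<close> by (simp add: of_nat_diff \<delta>_def algebra_simps)
    moreover have "1 / (2 * sqrt T) = 1 / sqrt T / 2"
      by simp
    ultimately show ?thesis
      using query_ge[OF that] \<delta>_T by linarith
  qed
  moreover have "is_arg_min f (\<lambda>x. x \<in> unit_ball) x0"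
    using x0 by (simp add: is_arg_min_linorder)
  moreover have "times_differentiable_on_ball k f"
    unfolding f_def by (intro times_differentiable_on_ball_smooth_pow \<open>r > 0\<close> cont_g)
  moreover have "\<exists>L. is_lipschitz_constant i f L \<and> L \<le> (10 * real k) ^ i * real T powr (2.5 * real i)"
    if "i \<le> k" for i
  proof -
    have "real T powr 2.5 = real T * real T * sqrt T"
      using powr_add[of "real T" 2 "1 / 2"] \<open>T > 0\<close>
      by (simp add: powr_half_sqrt power2_eq_square)
    then have "T / r = 10 * real k * real T powr 2.5"
      by (simp add: r_def)
    moreover have "(real T powr 2.5) ^ i = real T powr (2.5 * real i)"
      using \<open>T > 0\<close> powr_realpow[of "real T powr 2.5" i] by (simp add: powr_powr)
    ultimately have "(T / r) ^ i = (10 * real k) ^ i * real T powr (2.5 * real i)"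
      by (simp add: power_mult_distrib)
    moreover have "card (J ` {..<T}) = T"
      using inj by (simp add: card_image)
    ultimately show ?thesis
      using least_lipschitz_constant_smooth_pow[OF \<open>r > 0\<close> lip_g, of "J ` {..<T}" i k]
        depends_only_on_signed_max[of J T \<delta> s] that
      by (simp add: f_def g_def)
  qed
  ultimately show ?thesis
    using conv by blast
qed

end
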